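(* Let $\mathbf{y}=(y_1,y_2,y_3)\in\mathbb{N}^3$. Then $\mathbf{y}$ is minimally invariant if and only if $y_1<y_2$, $y_1<y_3$, and $y_1+y_3\ne y_2$.
   Context: $\mathbb{N}=\{1,2,3,\ldots\}$ and $[k]=\{1,\ldots,k\}$. Let $\mathbf{y}=(y_1,\ldots,y_n)\in\mathbb{N}^n$ be car lengths and $m=\sum_{i=1}^n y_i$. A one-way street has spots $1,\ldots,m$, initially empty. Given preferences $\mathbf{x}=(x_1,\ldots,x_n)\in[m]^n$, cars $1,\ldots,n$ enter in this order; car $i$ parks in spots $j,j+1,\ldots,j+y_i-1$, where $j\ge x_i$ is the smallest integer such that $j+y_i-1\le m$ and all these spots are unoccupied; if no such $j$ exists, parking fails. If all cars park, $\mathbf{x}$ is a parking assortment for $\mathbf{y}$; $\mathsf{PA}_n(\mathbf{y})$ is the set of these. $\mathsf{PA}^{\mathrm{inv}}_n(\mathbf{y})$ is the set of (permutation) invariant parking assortments: those $\mathbf{x}\in\mathsf{PA}_n(\mathbf{y})$ all of whose rearrangements are also in $\mathsf{PA}_n(\mathbf{y})$ (with $\mathbf{y}$ fixed). A list $\mathbf{y}\in\mathbb{N}^n$ is called minimally invariant if $\mathsf{PA}^{\mathrm{inv}}_n(\mathbf{y})=\{(1^n)\}$, where $(1^n)$ is the list of $n$ ones. *)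

theory Defs
  imports Main "HOL-Library.Multiset"
begin

(* Spots and cars are numbered from 1; a car of length l parked from spot j
   occupies {j..<j + l}, so the bound j + l - 1 \<le> m reads j + l \<le> m + 1
   (no truncated subtraction). *)

definition car_fits :: "nat \<Rightarrow> nat set \<Rightarrow> nat \<Rightarrow> nat \<Rightarrow> nat \<Rightarrow> bool" where
  "car_fits m occ p l j \<longleftrightarrow> p \<le> j \<and> j + l \<le> m + 1 \<and> {j..<j + l} \<inter> occ = {}"

(* all_park m occ xs ys: on a street with m spots, of which those in occ are already
   taken, the cars with preferences xs and lengths ys, entering in list order, all park.
   Lists of different lengths give False. *)

fun all_park :: "nat \<Rightarrow> nat set \<Rightarrow> nat list \<Rightarrow> nat list \<Rightarrow> bool" where
  "all_park m occ [] [] = True"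
| "all_park m occ (p # xs) (l # ys) =
     ((\<exists>j. car_fits m occ p l j) \<and>
      (let j = (LEAST j. car_fits m occ p l j)
       in all_park m (occ \<union> {j..<j + l}) xs ys))"
| "all_park m occ _ _ = False"

definition PA :: "nat list \<Rightarrow> nat list set" where
  "PA y = {x. length x = length y \<and> set x \<subseteq> {1..sum_list y} \<and>
              all_park (sum_list y) {} x y}"

definition PA_inv :: "nat list \<Rightarrow> nat list set" where
  "PA_inv y = {x \<in> PA y. \<forall>x'. mset x' = mset x \<longrightarrow> x' \<in> PA y}"

definition minimally_invariant :: "nat list \<Rightarrow> bool" where
  "minimally_invariant y \<longleftrightarrow> PA_inv y = {replicate (length y) 1}"

end

theory Submission
  imports Defs
begin

text \<open>
  Car 1 always parks at its preference and the three cars tile the street. So if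
  \<open>x\<close> is invariant, each of its entries lies in
  \<open>{1, 1 + y2, 1 + y3, 1 + y2 + y3}\<close>, and some entry is 1. If another entry \<open>v\<close> is
  not 1, rearrange \<open>x\<close> to begin with \<open>1, v\<close>. When \<open>y1 < y2\<close> and \<open>y1 < y3\<close>, spot \<open>v\<close> lies
  beyond spot \<open>y1 + 1\<close>, so car 2 parks exactly at \<open>v\<close>, leaving a gap behind car 1
  that car 3 has to fill; this forces \<open>y2 = y1 + y3\<close>. Conversely, \<open>(1, 1, 1 + y2)\<close> is
  invariant when \<open>y2 \<le> y1\<close> or \<open>y2 = y1 + y3\<close>, and \<open>(1, 1, 1 + y3)\<close> is when
  \<open>y3 \<le> y1 < y2\<close>.
\<close>

text \<open>Disjointness of two parked cars as linear inequalities, so that tiling arguments become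
  linear arithmetic.\<close>

definition separate :: "nat \<Rightarrow> nat \<Rightarrow> nat \<Rightarrow> nat \<Rightarrow> bool" where
  "separate i k j l \<longleftrightarrow> i + k \<le> j \<or> j + l \<le> i"

lemma disjoint_iff_separate:
  fixes i j k l :: nat
  assumes "k \<ge> 1" "l \<ge> 1"
  shows "{j..<j + l} \<inter> {i..<i + k} = {} \<longleftrightarrow> separate i k j l"
proof
  assume disj: "{j..<j + l} \<inter> {i..<i + k} = {}"
  show "separate i k j l"
  proof (rule ccontr)
    assume "\<not> separate i k j l"
    \<comment> \<open>Two overlapping nonempty intervals share the larger of their left
      ends.\<close>
    then have "max i j \<in> {j..<j + l} \<inter> {i..<i + k}"
      using assms by (auto simp: separate_def max_def)
    with disj show False by blast
  qed
qed (auto simp: separate_def)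

text \<open>Trades \<open>LEAST\<close> for an explicit spot with its minimality, which can be
  supplied as a witness or obtained.\<close>

lemma all_park_Cons_iff:
  "all_park m occ (p # xs) (l # ys) \<longleftrightarrow>
     (\<exists>j. car_fits m occ p l j \<and> (\<forall>j'. car_fits m occ p l j' \<longrightarrow> j \<le> j') \<and>
        all_park m (occ \<union> {j..<j + l}) xs ys)" (is "?L \<longleftrightarrow> ?R")
proof
  assume ?L
  then show ?R by (auto simp: Let_def intro: LeastI Least_le)
next
  assume ?R
  then obtain j where j: "car_fits m occ p l j" "\<forall>j'. car_fits m occ p l j' \<longrightarrow> j \<le> j'"
    "all_park m (occ \<union> {j..<j + l}) xs ys" by blast
  then have "(LEAST j. car_fits m occ p l j) = j" by (blast intro: Least_equality)
  with j show ?L by (auto simp: Let_def)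
qed

lemma all_park_single_iff: "all_park m occ [p] [l] \<longleftrightarrow> (\<exists>j. car_fits m occ p l j)"
  by simp

lemma car_fits_empty: "car_fits m {} p l j \<longleftrightarrow> p \<le> j \<and> j + l \<le> m + 1"
  by (simp add: car_fits_def)

text \<open>Car 1 meets an empty street and takes its preference. For car 3 any fitting spot will
  do, as no car follows it.\<close>

lemma all_park_three_iff:
  assumes "a \<ge> 1" "b \<ge> 1" "c \<ge> 1"
  shows "all_park m {} [p, q, r] [a, b, c] \<longleftrightarrow>
    p + a \<le> m + 1 \<and>
    (\<exists>j. q \<le> j \<and> j + b \<le> m + 1 \<and> separate p a j b \<and>
       (\<forall>j'. q \<le> j' \<and> j' + b \<le> m + 1 \<and> separate p a j' b \<longrightarrow> j \<le> j') \<and>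
       (\<exists>k. r \<le> k \<and> k + c \<le> m + 1 \<and> separate p a k c \<and> separate j b k c))"
proof -
  have second: "car_fits m {p..<p + a} q b j \<longleftrightarrow>
      q \<le> j \<and> j + b \<le> m + 1 \<and> separate p a j b" for j
    unfolding car_fits_def disjoint_iff_separate[OF assms(1,2)] ..
  have third: "car_fits m ({p..<p + a} \<union> {j..<j + b}) r c k \<longleftrightarrow>
      r \<le> k \<and> k + c \<le> m + 1 \<and> separate p a k c \<and> separate j b k c" for j k
    unfolding car_fits_def Int_Un_distrib Un_empty
      disjoint_iff_separate[OF assms(1,3)] disjoint_iff_separate[OF assms(2,3)] ..
  have first: "car_fits m {} p a i \<and> (\<forall>i'. car_fits m {} p a i' \<longrightarrow> i \<le> i') \<longleftrightarrow>
      i = p \<and> p + a \<le> m + 1" for i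
    by (auto simp: car_fits_empty)
  have "all_park m {} [p, q, r] [a, b, c] \<longleftrightarrow>
      p + a \<le> m + 1 \<and> all_park m {p..<p + a} [q, r] [b, c]"
    by (simp only: all_park_Cons_iff[of m "{}"] conj_assoc[symmetric] first)
       (simp del: all_park.simps)
  also have "all_park m {p..<p + a} [q, r] [b, c] \<longleftrightarrow>
    (\<exists>j. car_fits m {p..<p + a} q b j \<and> (\<forall>j'. car_fits m {p..<p + a} q b j' \<longrightarrow> j \<le> j') \<and>
       (\<exists>k. car_fits m ({p..<p + a} \<union> {j..<j + b}) r c k))"
    unfolding all_park_Cons_iff[of m _ q] all_park_single_iff ..
  finally show ?thesis unfolding second third by (simp only: conj_assoc)
qed

lemma PA_three_I:
  assumes "a \<ge> 1" "b \<ge> 1" "c \<ge> 1"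
    and "{p, q, r} \<subseteq> {1..a + b + c}" "p + a \<le> a + b + c + 1"
    and "q \<le> j" "j + b \<le> a + b + c + 1" "separate p a j b"
    and "\<forall>j'. q \<le> j' \<and> j' + b \<le> a + b + c + 1 \<and> separate p a j' b \<longrightarrow> j \<le> j'"
    and "r \<le> k" "k + c \<le> a + b + c + 1" "separate p a k c" "separate j b k c"
  shows "[p, q, r] \<in> PA [a, b, c]"
proof -
  have "all_park (a + b + c) {} [p, q, r] [a, b, c]"
    unfolding all_park_three_iff[OF assms(1-3)]
    by (rule conjI[OF assms(5) exI[of _ j]]) (intro conjI exI[of _ k] assms(6-))
  then show ?thesis using assms(4) by (simp add: PA_def add.assoc)
qed

lemma PA_three_E:
  assumes "a \<ge> 1" "b \<ge> 1" "c \<ge> 1" and "[p, q, r] \<in> PA [a, b, c]"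
  obtains j k where "p \<ge> 1" "q \<ge> 1" "r \<ge> 1" "p + a \<le> a + b + c + 1"
    "q \<le> j" "j + b \<le> a + b + c + 1" "separate p a j b"
    "\<forall>j'. q \<le> j' \<and> j' + b \<le> a + b + c + 1 \<and> separate p a j' b \<longrightarrow> j \<le> j'"
    "r \<le> k" "k + c \<le> a + b + c + 1" "separate p a k c" "separate j b k c"
proof -
  have "all_park (a + b + c) {} [p, q, r] [a, b, c]"
    using assms(4) by (simp add: PA_def add.assoc)
  moreover have "p \<ge> 1" "q \<ge> 1" "r \<ge> 1" using assms(4) by (auto simp: PA_def)
  ultimately show ?thesis
    unfolding all_park_three_iff[OF assms(1-3)] using that by blast
qed

text \<open>Disjoint cars of total length \<open>a + b + c\<close> fill the street, so one of them
  starts at spot 1, and its preference cannot exceed 1.\<close>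

lemma PA_three_has_one:
  assumes pos: "a \<ge> 1" "b \<ge> 1" "c \<ge> 1" and x: "[p, q, r] \<in> PA [a, b, c]"
  shows "1 \<in> {p, q, r}"
proof -
  obtain j k where "p \<ge> 1" "q \<ge> 1" "r \<ge> 1" "p + a \<le> a + b + c + 1"
    "q \<le> j" "j + b \<le> a + b + c + 1" "separate p a j b"
    "r \<le> k" "k + c \<le> a + b + c + 1" "separate p a k c" "separate j b k c"
    by (rule PA_three_E[OF pos x]) (rule that)
  then have "p = 1 \<or> q = 1 \<or> r = 1" using pos unfolding separate_def by linarith
  then show ?thesis by blast
qed

text \<open>The spots before car 1 are tiled by some of the other two cars.\<close>

lemma PA_three_first:
  assumes pos: "a \<ge> 1" "b \<ge> 1" "c \<ge> 1" and x: "[p, q, r] \<in> PA [a, b, c]"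
  shows "p \<in> {1, 1 + b, 1 + c, 1 + b + c}"
proof -
  obtain j k where "p \<ge> 1" "q \<ge> 1" "r \<ge> 1" "p + a \<le> a + b + c + 1"
    "q \<le> j" "j + b \<le> a + b + c + 1" "separate p a j b"
    "r \<le> k" "k + c \<le> a + b + c + 1" "separate p a k c" "separate j b k c"
    by (rule PA_three_E[OF pos x]) (rule that)
  then have "p = 1 \<or> p = 1 + b \<or> p = 1 + c \<or> p = 1 + b + c"
    using pos unfolding separate_def by linarith
  then show ?thesis by blast
qed

lemma PA_three_second:
  assumes pos: "a \<ge> 1" "b \<ge> 1" "c \<ge> 1" and x: "[1, v, w] \<in> PA [a, b, c]" and "v > 1 + a"
  shows "v = 1 + a + c"
proof -
  obtain j k where jk: "w \<ge> 1"
    "v \<le> j" "j + b \<le> a + b + c + 1" "separate 1 a j b"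
    "\<forall>j'. v \<le> j' \<and> j' + b \<le> a + b + c + 1 \<and> separate 1 a j' b \<longrightarrow> j \<le> j'"
    "w \<le> k" "k + c \<le> a + b + c + 1" "separate 1 a k c" "separate j b k c"
    by (rule PA_three_E[OF pos x]) (rule that)
  \<comment> \<open>Spot \<open>v\<close> itself suits car 2: it lies beyond car 1, and it leaves
    enough room because the start \<open>j \<ge> v\<close> does.\<close>
  have "j \<le> v" using jk(2,3) assms(5) by (intro jk(5)[rule_format]) (auto simp: separate_def)
  then show ?thesis
    using jk(1-4,6-) assms(5) pos unfolding separate_def by linarith
qed

lemma mset_eq_two_ones:
  assumes "mset x = mset [1, 1, v :: nat]"
  shows "x \<in> {[1, 1, v], [1, v, 1], [v, 1, 1]}"
proof -
  have "length x = 3" using mset_eq_length[OF assms] by simp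
  then obtain p q r where x: "x = [p, q, r]"
    by (auto simp: numeral_eq_Suc length_Suc_conv)
  show ?thesis using assms unfolding x by (simp add: add_eq_conv_diff) auto
qed

lemma two_ones_in_PA_inv_I:
  assumes "[1, 1, v] \<in> PA y" "[1, v, 1] \<in> PA y" "[v, 1, 1] \<in> PA y"
  shows "[1, 1, v] \<in> PA_inv y"
  using assms mset_eq_two_ones[of _ v] unfolding PA_inv_def by blast

lemma ones_in_PA_inv:
  assumes "a \<ge> 1" "b \<ge> 1" "c \<ge> 1"
  shows "[1, 1, 1] \<in> PA_inv [a, b, c]"
proof -
  have "[1, 1, 1] \<in> PA [a, b, c]"
    by (rule PA_three_I[where j = "1 + a" and k = "1 + a + b"])
       (use assms in \<open>auto simp: separate_def\<close>)
  from two_ones_in_PA_inv_I[OF this this this] show ?thesis .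
qed

lemma PA_inv_eq_ones:
  assumes pos: "a \<ge> 1" "b \<ge> 1" "c \<ge> 1" and lt: "a < b" "a < c" "a + c \<noteq> b"
    and x: "x \<in> PA_inv [a, b, c]"
  shows "x = [1, 1, 1]"
proof (rule ccontr)
  assume ne: "x \<noteq> [1, 1, 1]"
  from x have "length x = 3" by (simp add: PA_inv_def PA_def)
  then obtain p q r where pqr: "x = [p, q, r]"
    by (auto simp: numeral_eq_Suc length_Suc_conv)
  have inv: "x' \<in> PA [a, b, c]" if "mset x' = mset [p, q, r]" for x'
    using x that by (auto simp: PA_inv_def pqr)
  have "1 \<in> {p, q, r}" using PA_three_has_one[OF pos inv] by blast
  moreover have "p \<noteq> 1 \<or> q \<noteq> 1 \<or> r \<noteq> 1" using ne by (simp add: pqr)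
  \<comment> \<open>All six orders: whichever entry is 1 and whichever is not, some order puts these
    two first.\<close>
  moreover have "mset [p, q, r] = mset [q, p, r]" "mset [p, q, r] = mset [r, p, q]"
    "mset [p, q, r] = mset [p, r, q]" "mset [p, q, r] = mset [q, r, p]"
    "mset [p, q, r] = mset [r, q, p]"
    by simp_all
  ultimately obtain v w where vw: "v \<noteq> 1" "mset [p, q, r] = mset [1, v, w]"
    by (metis insertE empty_iff)
  have "[1, v, w] \<in> PA [a, b, c]" "[v, 1, w] \<in> PA [a, b, c]"
    by (rule inv; simp only: vw(2); simp)+
  from PA_three_first[OF pos this(2)] vw(1) have v: "v \<in> {1 + b, 1 + c, 1 + b + c}" by blast
  with lt have "v > 1 + a" by auto
  \<comment> \<open>Equating \<open>1 + a + c\<close> with the three values of \<open>v\<close>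
    gives \<open>b = a + c\<close>, \<open>a = 0\<close> or \<open>a = b\<close>, all
    excluded.\<close>
  with PA_three_second[OF pos \<open>[1, v, w] \<in> _\<close>] v lt pos show False by auto
qed

lemma two_ones_in_PA_inv_left:
  assumes pos: "a \<ge> 1" "b \<ge> 1" "c \<ge> 1" and "b \<le> a \<or> b = a + c"
  shows "[1, 1, 1 + b] \<in> PA_inv [a, b, c]"
proof (rule two_ones_in_PA_inv_I)
  show "[1, 1, 1 + b] \<in> PA [a, b, c]"
    by (rule PA_three_I[where j = "1 + a" and k = "1 + a + b"])
       (use pos in \<open>auto simp: separate_def\<close>)
  show "[1, 1 + b, 1] \<in> PA [a, b, c]"
  proof (cases "b \<le> a")
    case True
    \<comment> \<open>Preference \<open>1 + b\<close> is at most \<open>1 + a\<close>, so car 2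
      still parks directly behind car 1.\<close>
    show ?thesis
      by (rule PA_three_I[where j = "1 + a" and k = "1 + a + b"])
         (use pos True in \<open>auto simp: separate_def\<close>)
  next
    case False
    \<comment> \<open>Now \<open>b = a + c\<close>: car 2 takes the last \<open>b\<close> spots and
      leaves a gap of length \<open>c\<close> for car 3.\<close>
    show ?thesis
      by (rule PA_three_I[where j = "1 + b" and k = "1 + a"])
         (use assms False in \<open>auto simp: separate_def\<close>)
  qed
  \<comment> \<open>Car 1 leaves exactly \<open>b\<close> spots in front, which car 2 fills.\<close>
  show "[1 + b, 1, 1] \<in> PA [a, b, c]"
    by (rule PA_three_I[where j = 1 and k = "1 + a + b"])
       (use pos in \<open>auto simp: separate_def\<close>)
qed

lemma two_ones_in_PA_inv_right:
  assumes pos: "a \<ge> 1" "b \<ge> 1" "c \<ge> 1" and "c \<le> a" "a < b"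
  shows "[1, 1, 1 + c] \<in> PA_inv [a, b, c]"
proof (rule two_ones_in_PA_inv_I)
  show "[1, 1, 1 + c] \<in> PA [a, b, c]" "[1, 1 + c, 1] \<in> PA [a, b, c]"
    by (rule PA_three_I[where j = "1 + a" and k = "1 + a + b"];
        use assms in \<open>auto simp: separate_def\<close>)+
  \<comment> \<open>Since \<open>c < b\<close>, car 2 is too long for the \<open>c\<close> spots
    before car 1; it parks behind, and car 3 fills them.\<close>
  show "[1 + c, 1, 1] \<in> PA [a, b, c]"
    by (rule PA_three_I[where j = "1 + c + a" and k = 1])
       (use assms in \<open>auto simp: separate_def\<close>)
qed

theorem theorem5p3:
  fixes y1 y2 y3 :: nat
  assumes "y1 \<ge> 1" and "y2 \<ge> 1" and "y3 \<ge> 1"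
  shows "minimally_invariant [y1, y2, y3] \<longleftrightarrow> y1 < y2 \<and> y1 < y3 \<and> y1 + y3 \<noteq> y2"
proof -
  have min_inv: "minimally_invariant [y1, y2, y3] \<longleftrightarrow> PA_inv [y1, y2, y3] = {[1, 1, 1]}"
    by (simp add: minimally_invariant_def)
  show ?thesis
  proof
    assume "minimally_invariant [y1, y2, y3]"
    then have only: "v = 1" if "[1, 1, v] \<in> PA_inv [y1, y2, y3]" for v
      using that by (simp add: min_inv)
    have "\<not> (y2 \<le> y1 \<or> y2 = y1 + y3)"
      using only[OF two_ones_in_PA_inv_left[OF assms]] assms by auto
    moreover have "\<not> (y3 \<le> y1 \<and> y1 < y2)"
      using only[OF two_ones_in_PA_inv_right[OF assms]] assms by auto
    \<comment> \<open>The case \<open>y2 \<le> y1\<close> is already refuted, so assuming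
      \<open>y1 < y2\<close> in the second refutation loses nothing.\<close>
    ultimately show "y1 < y2 \<and> y1 < y3 \<and> y1 + y3 \<noteq> y2" by auto
  next
    assume "y1 < y2 \<and> y1 < y3 \<and> y1 + y3 \<noteq> y2"
    then show "minimally_invariant [y1, y2, y3]"
      unfolding min_inv using PA_inv_eq_ones[OF assms] ones_in_PA_inv[OF assms] by blast
  qed
qed

end
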